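(* Let $n\ge 1$, let $f:\{0,1\}^n\to\{1,-1\}$ be a Boolean function, let $S\subseteq\{0,1\}^n$, and let $g:\{0,1\}^n\to\{1,-1\}$ be defined by $g(\mathbf{x})=-1$ if $\mathbf{x}\in S$ and $g(\mathbf{x})=1$ otherwise. Put $$p=\frac{1}{2^{2n}}\sum_{\mathbf{x}\in S}W_f(\mathbf{x})^2 .$$ Then the probability that the $n$-bit output of the algorithm $\mathcal{A}^{(3,3)}(f,g,f)$ has at least one bit equal to $1$ is $4p-4p^2$.
   Context: The Walsh transform of $f:\{0,1\}^n\to\{1,-1\}$ is $W_f(\boldsymbol{\omega})=\sum_{\mathbf{x}\in\{0,1\}^n}f(\mathbf{x})(-1)^{\mathbf{x}\cdot\boldsymbol{\omega}}$, where $\mathbf{x}\cdot\boldsymbol{\omega}=x_1\omega_1\oplus\cdots\oplus x_n\omega_n$. The oracle $U_h$ of a function $h:\{0,1\}^n\to\{1,-1\}$ is the unitary on $n+1$ qubits given by $U_h|\mathbf{x}\rangle|a\rangle=|\mathbf{x}\rangle\left|a\oplus\frac{1-h(\mathbf{x})}{2}\right\rangle$; in particular $U_h|\mathbf{x}\rangle|-\rangle=h(\mathbf{x})|\mathbf{x}\rangle|-\rangle$, where $|-\rangle=\frac{1}{\sqrt2}(|0\rangle-|1\rangle)$. $H$ is the $2\times2$ (normalized) Hadamard gate. The algorithm $\mathcal{A}^{(3,3)}(f_1,f_2,f_3)$, for $f_1,f_2,f_3:\{0,1\}^n\to\{1,-1\}$: start from the $(n+1)$-qubit state $|0\rangle^{\otimes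 n}|-\rangle$; apply in this order $H^{\otimes n}$, $U_{f_1}$, $H^{\otimes n}$, $U_{f_2}$, $H^{\otimes n}$, $U_{f_3}$, $H^{\otimes n}$, where each $H^{\otimes n}$ acts on the first $n$ qubits; finally measure the first $n$ qubits in the computational basis, giving an $n$-bit output. *)

theory Defs
  imports "HOL-Analysis.Analysis" "HOL-Library.Z2"
begin

instance bit :: finite
proof
  have "(UNIV :: bit set) = {0, 1}"
    by auto
  then show "finite (UNIV :: bit set)"
    by (metis finite.emptyI finite.insertI)
qed

text \<open>
  Bit strings of length \<open>n = CARD('n)\<close> are vectors over the two-element field \<^typ>\<open>bit\<close>,
  whose addition is exclusive or. A pure state of a register whose computational
  basis is indexed by a finite type \<open>'a\<close> is a vector of type \<open>complex ^ 'a\<close>;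
  a matrix is indexed by row first, so column \<open>j\<close> is the image of the \<open>j\<close>-th basis state.
\<close>

type_synonym 'n bits = "bit ^ 'n"

definition bit_dot :: "'n::finite bits \<Rightarrow> 'n bits \<Rightarrow> bit"
  where "bit_dot x w = (\<Sum>i\<in>UNIV. x $ i * w $ i)"

definition walsh :: "('n::finite bits \<Rightarrow> int) \<Rightarrow> 'n bits \<Rightarrow> int"
  where "walsh f w = (\<Sum>x\<in>UNIV. f x * (-1) ^ of_bit (bit_dot x w))"

definition ket :: "'a::finite \<Rightarrow> complex ^ 'a"
  where "ket x = axis x 1"

definition ket_minus :: "complex ^ bit"
  where "ket_minus = complex_of_real (1 / sqrt 2) *s (ket 0 - ket 1)"

definition tensor_vec :: "complex ^ 'a::finite \<Rightarrow> complex ^ 'b::finite \<Rightarrow> complex ^ ('a \<times> 'b)"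
  where "tensor_vec u v = (\<chi> k. u $ fst k * v $ snd k)"

definition tensor_mat ::
    "complex ^ 'a ^ 'a::finite \<Rightarrow> complex ^ 'b ^ 'b::finite \<Rightarrow> complex ^ ('a \<times> 'b) ^ ('a \<times> 'b)"
  where "tensor_mat A B = (\<chi> j k. A $ fst j $ fst k * B $ snd j $ snd k)"

definition tensor_power_vec :: "complex ^ 'q::finite \<Rightarrow> complex ^ ('q ^ 'n::finite)"
  where "tensor_power_vec u = (\<chi> x. \<Prod>i\<in>UNIV. u $ (x $ i))"

definition tensor_power_mat ::
    "complex ^ 'q ^ 'q::finite \<Rightarrow> complex ^ ('q ^ 'n::finite) ^ ('q ^ 'n)"
  where "tensor_power_mat A = (\<chi> y x. \<Prod>i\<in>UNIV. A $ (y $ i) $ (x $ i))"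

definition hadamard :: "complex ^ bit ^ bit"
  where "hadamard = (\<chi> b a. (if a = 1 \<and> b = 1 then -1 else 1) / complex_of_real (sqrt 2))"

definition hadamard_layer :: "complex ^ ('n::finite bits \<times> bit) ^ ('n bits \<times> bit)"
  where "hadamard_layer = tensor_mat (tensor_power_mat hadamard) (mat 1)"

definition U_gate ::
    "('n::finite bits \<Rightarrow> int) \<Rightarrow> complex ^ ('n bits \<times> bit) ^ ('n bits \<times> bit)"
  where "U_gate h =
    (\<chi> j k. of_bool (j = (fst k, snd k + of_int ((1 - h (fst k)) div 2))))"

definition algorithm33_state ::
    "('n::finite bits \<Rightarrow> int) \<Rightarrow> ('n bits \<Rightarrow> int) \<Rightarrow> ('n bits \<Rightarrow> int) \<Rightarrow> complex ^ ('n bits \<times> bit)"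
  where "algorithm33_state f1 f2 f3 =
    hadamard_layer *v (U_gate f3 *v (hadamard_layer *v (U_gate f2 *v
      (hadamard_layer *v (U_gate f1 *v (hadamard_layer *v
        tensor_vec (tensor_power_vec (ket 0)) ket_minus))))))"

text \<open>Born rule for measuring only the first \<open>n\<close> qubits: the last qubit is summed out.\<close>

definition outcome_prob :: "complex ^ ('n::finite bits \<times> bit) \<Rightarrow> 'n bits \<Rightarrow> real"
  where "outcome_prob \<psi> y = (\<Sum>a\<in>UNIV. (cmod (\<psi> $ (y, a)))\<^sup>2)"

definition algorithm33_prob ::
    "('n::finite bits \<Rightarrow> int) \<Rightarrow> ('n bits \<Rightarrow> int) \<Rightarrow> ('n bits \<Rightarrow> int) \<Rightarrow> 'n bits set \<Rightarrow> real"
  where "algorithm33_prob f1 f2 f3 E = (\<Sum>y\<in>E. outcome_prob (algorithm33_state f1 f2 f3) y)"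

lemma tensor_vec_ket: "tensor_vec (ket x) (ket a) = ket (x, a)"
  by (auto simp: tensor_vec_def ket_def axis_def vec_eq_iff)

lemma tensor_power_vec_ket_0: "tensor_power_vec (ket 0) = (ket 0 :: complex ^ ('n::finite bits))"
proof -
  have "(\<Prod>i\<in>UNIV. ket 0 $ (x $ i)) = (ket 0 :: complex ^ ('n bits)) $ x" for x :: "'n bits"
  proof (cases "x = 0")
    case True
    then show ?thesis by (simp add: ket_def axis_def)
  next
    case False
    then obtain i where "x $ i \<noteq> 0" by (metis vec_eq_iff zero_index)
    then have "(ket 0 :: complex ^ bit) $ (x $ i) = 0" by (simp add: ket_def axis_def)
    then have "(\<Prod>i\<in>UNIV. (ket 0 :: complex ^ bit) $ (x $ i)) = 0" by (meson UNIV_I finite prod_zero)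
    with False show ?thesis by (simp add: ket_def axis_def)
  qed
  then show ?thesis by (simp add: tensor_power_vec_def vec_eq_iff del: bit_not_zero_iff)
qed

lemma U_gate_ket:
  "U_gate h *v tensor_vec (ket x) (ket a) =
    tensor_vec (ket x) (ket (a + of_int ((1 - h x) div 2)))"
proof -
  have "(U_gate h *v ket (x, a)) $ j = ket (x, a + of_int ((1 - h x) div 2)) $ j" for j
    by (simp add: ket_def axis_def U_gate_def matrix_vector_mult_def if_distrib cong: if_cong
        del: add_bit_eq_xor)
  then show ?thesis by (simp only: tensor_vec_ket vec_eq_iff) blast
qed

lemma U_gate_ket_minus:
  assumes "h x \<in> {1, -1}"
  shows "U_gate h *v tensor_vec (ket x) ket_minus = of_int (h x) *s tensor_vec (ket x) ket_minus"
proof -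
  have minus: "tensor_vec (ket x) ket_minus = complex_of_real (1 / sqrt 2) *s
      (tensor_vec (ket x) (ket 0) - tensor_vec (ket x) (ket 1))"
    by (simp add: tensor_vec_def ket_minus_def vec_eq_iff right_diff_distrib mult.left_commute)
  have "U_gate h *v tensor_vec (ket x) ket_minus = complex_of_real (1 / sqrt 2) *s
      (tensor_vec (ket x) (ket (0 + of_int ((1 - h x) div 2))) -
       tensor_vec (ket x) (ket (1 + of_int ((1 - h x) div 2))))"
    unfolding minus by (simp only: vector_scalar_commute matrix_vector_mult_diff_distrib U_gate_ket)
  also have "\<dots> = of_int (h x) *s tensor_vec (ket x) ket_minus"
  proof (cases "h x = 1")
    case True
    then show ?thesis unfolding minus by simp
  next
    case False
    with assms have "h x = -1" by simp
    then show ?thesis unfolding minus by (simp add: vec_eq_iff right_diff_distrib)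
  qed
  finally show ?thesis .
qed

end

theory Submission
  imports Defs
begin

text \<open>
  Phase kickback keeps the last qubit in the minus state, so only a real amplitude function on the
  first \<open>n\<close> qubits has to be followed. The Hadamard layer \<open>H\<close> acts on it as a symmetric
  involution. With \<open>\<phi> = f / sqrt (2 ^ n)\<close>, the final amplitude at \<open>0\<close> is
  \<open>\<langle>\<phi>, H (g * H \<phi>)\<rangle> = \<langle>H \<phi>, g * H \<phi>\<rangle> = 1 - 2 * p\<close>, where \<open>H \<phi> = W_f / 2 ^ n\<close> has norm \<open>1\<close>.
  As the final state has norm \<open>1\<close>, a nonzero outcome has probability \<open>1 - (1 - 2 * p)\<^sup>2\<close>.
\<close>

lemma UNIV_bit: "(UNIV :: bit set) = {0, 1}"
  by auto

text \<open>The nontrivial additive character of the two-element field, taken with real values so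
  that amplitudes stay real.\<close>

definition bit_sign :: "bit \<Rightarrow> real"
  where "bit_sign b = (-1) ^ of_bit b"

lemma bit_sign_simps [simp]: "bit_sign 0 = 1" "bit_sign 1 = -1"
  by (simp_all add: bit_sign_def)

lemma bit_sign_add: "bit_sign (a + b) = bit_sign a * bit_sign b"
  by (cases a; cases b) simp_all

lemma bit_sign_sum: "finite A \<Longrightarrow> bit_sign (sum h A) = (\<Prod>i\<in>A. bit_sign (h i))"
  by (induction A rule: finite_induct) (simp_all add: bit_sign_add del: add_bit_eq_xor)

lemma bit_dot_commute: "bit_dot x w = bit_dot w x"
  by (simp add: bit_dot_def mult.commute del: mult_bit_eq_and)

lemma bit_dot_add_left: "bit_dot (x + y) w = bit_dot x w + bit_dot y w"
  by (simp add: bit_dot_def distrib_right sum.distrib del: add_bit_eq_xor mult_bit_eq_and)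

lemma bit_dot_axis: "bit_dot (axis i 1) w = w $ i"
proof -
  have "bit_dot (axis i 1) w = (\<Sum>j\<in>UNIV. if j = i then w $ j else 0)"
    unfolding bit_dot_def by (intro sum.cong) (auto simp: axis_def)
  then show ?thesis by simp
qed

lemma bits_add_eq_0_iff: "x + y = 0 \<longleftrightarrow> x = (y :: 'n::finite bits)"
proof -
  have "a + b = 0 \<longleftrightarrow> a = b" for a b :: bit
    by (cases a; cases b) simp_all
  then show ?thesis by (simp add: vec_eq_iff del: add_bit_eq_xor)
qed

text \<open>Orthogonality of characters: if \<open>z $ i = 1\<close>, adding \<open>axis i 1\<close>
  to \<open>y\<close> permutes the strings and flips every sign, so the sum equals its own
  negative.\<close>

lemma sum_bit_sign_bit_dot:
  fixes z :: "'n::finite bits"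
  shows "(\<Sum>y\<in>UNIV. bit_sign (bit_dot y z)) = (if z = 0 then 2 ^ CARD('n) else 0)"
proof (cases "z = 0")
  case True
  have "CARD(bit) = 2"
    by (simp add: UNIV_bit)
  with True show ?thesis by (simp add: bit_dot_def)
next
  case False
  then obtain i where "z $ i \<noteq> 0" by (metis vec_eq_iff zero_index)
  then have i: "z $ i = 1" by simp
  have "(\<Sum>y\<in>UNIV. bit_sign (bit_dot y z)) = (\<Sum>y\<in>UNIV. bit_sign (bit_dot (y + axis i 1) z))"
    by (rule sum.reindex_bij_witness[where i = "\<lambda>y. y + axis i 1" and j = "\<lambda>y. y - axis i 1"]) auto
  also have "\<dots> = - (\<Sum>y\<in>UNIV. bit_sign (bit_dot y z))"
    by (simp add: bit_dot_add_left bit_dot_axis i bit_sign_add sum_negf del: add_bit_eq_xor)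
  finally show ?thesis using False by simp
qed

text \<open>The Walsh-Hadamard transform on real amplitudes, scaled to be orthogonal.\<close>

definition hadamard_transform :: "('n::finite bits \<Rightarrow> real) \<Rightarrow> 'n bits \<Rightarrow> real"
  where "hadamard_transform u y = (\<Sum>x\<in>UNIV. bit_sign (bit_dot x y) * u x) / sqrt 2 ^ CARD('n)"

text \<open>The kernel is symmetric because \<open>bit_dot\<close> is; swapping the two sums then
  moves the transform across the inner product.\<close>

lemma hadamard_transform_adjoint:
  "(\<Sum>y\<in>UNIV. hadamard_transform u y * v y) = (\<Sum>x\<in>UNIV. u x * hadamard_transform v x)"
proof -
  have "(\<Sum>y\<in>UNIV. hadamard_transform u y * v y) =
      (\<Sum>y\<in>UNIV. \<Sum>x\<in>UNIV. bit_sign (bit_dot x y) * u x * v y / sqrt 2 ^ CARD('a))"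
    by (simp add: hadamard_transform_def sum_divide_distrib sum_distrib_right)
  also have "\<dots> = (\<Sum>x\<in>UNIV. \<Sum>y\<in>UNIV. bit_sign (bit_dot x y) * u x * v y / sqrt 2 ^ CARD('a))"
    by (rule sum.swap)
  also have "\<dots> = (\<Sum>x\<in>UNIV. u x * hadamard_transform v x)"
    by (simp add: hadamard_transform_def sum_divide_distrib sum_distrib_left bit_dot_commute mult_ac)
  finally show ?thesis .
qed

text \<open>Multiplying two kernels and summing over the middle index gives the character sum at
  \<open>x + z\<close>, and in characteristic two this vector is zero only for
  \<open>x = z\<close>.\<close>

lemma hadamard_transform_involutive: "hadamard_transform (hadamard_transform u) = u"
proof
  fix z :: "'a bits"
  have "bit_sign (bit_dot y z) * bit_sign (bit_dot x y) = bit_sign (bit_dot y (x + z))" for x y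
    by (simp add: bit_dot_commute[of y] bit_dot_add_left bit_sign_add del: add_bit_eq_xor)
  then have orth: "(\<Sum>y\<in>UNIV. bit_sign (bit_dot y z) * bit_sign (bit_dot x y)) =
      (if x = z then 2 ^ CARD('a) else 0)" for x
    by (simp add: sum_bit_sign_bit_dot bits_add_eq_0_iff del: add_bit_eq_xor)
  have s: "sqrt 2 ^ CARD('a) * sqrt 2 ^ CARD('a) = 2 ^ CARD('a)"
    by (simp flip: power_mult_distrib)
  have "hadamard_transform (hadamard_transform u) z =
      (\<Sum>y\<in>UNIV. \<Sum>x\<in>UNIV. bit_sign (bit_dot y z) * bit_sign (bit_dot x y) * u x) / 2 ^ CARD('a)"
    unfolding hadamard_transform_def s[symmetric]
    by (simp add: sum_distrib_left sum_divide_distrib mult_ac)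
  also have "\<dots> = (\<Sum>x\<in>UNIV. (\<Sum>y\<in>UNIV. bit_sign (bit_dot y z) * bit_sign (bit_dot x y)) * u x)
      / 2 ^ CARD('a)"
    by (subst sum.swap) (simp add: sum_distrib_right)
  also have "\<dots> = u z"
    by (simp add: orth if_distrib[of "\<lambda>a. a * _"] cong: if_cong)
  finally show "hadamard_transform (hadamard_transform u) z = u z" .
qed

text \<open>Parseval's identity: a symmetric involution preserves the norm.\<close>

lemma hadamard_transform_sum_squares:
  "(\<Sum>y\<in>UNIV. (hadamard_transform u y)\<^sup>2) = (\<Sum>x\<in>UNIV. (u x)\<^sup>2)"
  using hadamard_transform_adjoint[of u "hadamard_transform u"]
  by (simp add: power2_eq_square hadamard_transform_involutive)

definition minus_state :: "('n::finite bits \<Rightarrow> real) \<Rightarrow> complex ^ ('n bits \<times> bit)"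
  where "minus_state u = tensor_vec (\<chi> x. complex_of_real (u x)) ket_minus"

text \<open>Each factor is the sign of a product of two bits over \<open>sqrt 2\<close>, and a
  product of signs is the sign of the sum of the bits.\<close>

lemma tensor_power_hadamard_nth:
  fixes x y :: "'n::finite bits"
  shows "tensor_power_mat hadamard $ y $ x =
    complex_of_real (bit_sign (bit_dot x y) / sqrt 2 ^ CARD('n))"
proof -
  have "hadamard $ b $ a = complex_of_real (bit_sign (a * b) / sqrt 2)" for a b
    by (cases a; cases b) (simp_all add: hadamard_def)
  then have "tensor_power_mat hadamard $ y $ x =
      complex_of_real (\<Prod>i\<in>UNIV. bit_sign (x $ i * y $ i) / sqrt 2)"
    by (simp add: tensor_power_mat_def)
  also have "(\<Prod>i\<in>UNIV. bit_sign (x $ i * y $ i) / sqrt 2) =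
      bit_sign (bit_dot x y) / sqrt 2 ^ CARD('n)"
    by (simp add: bit_dot_def bit_sign_sum prod_dividef del: mult_bit_eq_and)
  finally show ?thesis .
qed

lemma hadamard_layer_minus_state:
  "hadamard_layer *v minus_state u = minus_state (hadamard_transform u)"
proof -
  have "(hadamard_layer *v minus_state u) $ (y, a) = minus_state (hadamard_transform u) $ (y, a)"
    for y a
  proof -
    have "(hadamard_layer *v minus_state u) $ (y, a) =
      (\<Sum>x\<in>UNIV. \<Sum>b\<in>UNIV. tensor_power_mat hadamard $ y $ x * (mat 1 :: complex ^ bit ^ bit) $ a $ b *
        (complex_of_real (u x) * ket_minus $ b))"
      by (simp add: matrix_vector_mult_def hadamard_layer_def tensor_mat_def minus_state_def
          tensor_vec_def sum.cartesian_product case_prod_unfold)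
    also have "\<dots> = (\<Sum>x\<in>UNIV. tensor_power_mat hadamard $ y $ x * complex_of_real (u x)) * ket_minus $ a"
    proof -
      have "(\<Sum>b\<in>UNIV. c * (mat 1 :: complex ^ bit ^ bit) $ a $ b * (d * ket_minus $ b)) =
        c * d * ket_minus $ a" for c d
        by (cases a) (simp_all add: mat_def UNIV_bit)
      then show ?thesis by (simp add: sum_distrib_right)
    qed
    also have "\<dots> = minus_state (hadamard_transform u) $ (y, a)"
      by (simp add: tensor_power_hadamard_nth minus_state_def tensor_vec_def
          hadamard_transform_def sum_divide_distrib)
    finally show ?thesis .
  qed
  then show ?thesis by (simp add: vec_eq_iff split_paired_all)
qed

text \<open>Each basis string tensored with \<open>ket_minus\<close> is an eigenvector of the oracle
  with eigenvalue \<open>h x\<close>; linearity does the rest.\<close>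

lemma U_gate_minus_state:
  assumes "\<And>x. h x \<in> {1, -1}"
  shows "U_gate h *v minus_state u = minus_state (\<lambda>x. of_int (h x) * u x)"
proof -
  have expand: "minus_state v = (\<Sum>x\<in>UNIV. complex_of_real (v x) *s tensor_vec (ket x) ket_minus)"
    for v :: "'a bits \<Rightarrow> real"
  proof -
    have "(\<Sum>x\<in>UNIV. complex_of_real (v x) * (ket x $ y * c)) = complex_of_real (v y) * c" for y c
    proof -
      have "(\<Sum>x\<in>UNIV. complex_of_real (v x) * (ket x $ y * c)) =
          (\<Sum>x\<in>UNIV. if x = y then complex_of_real (v x) * c else 0)"
        by (intro sum.cong) (auto simp: ket_def axis_def)
      then show ?thesis by simp
    qed
    then show ?thesis
      by (simp add: vec_eq_iff minus_state_def tensor_vec_def)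
  qed
  have "U_gate h *v minus_state u =
      (\<Sum>x\<in>UNIV. U_gate h *v (complex_of_real (u x) *s tensor_vec (ket x) ket_minus))"
    unfolding expand by (rule vec.linear_sum[OF matrix_vector_mul_linear_gen])
  also have "\<dots> = minus_state (\<lambda>x. of_int (h x) * u x)"
    unfolding expand
    by (simp add: vector_scalar_commute U_gate_ket_minus[of h, OF assms] vector_smult_assoc mult.commute)
  finally show ?thesis .
qed

text \<open>Both values of the last qubit contribute half, as the entries of
  \<open>ket_minus\<close> have modulus \<open>1 / sqrt 2\<close>.\<close>

lemma outcome_prob_minus_state: "outcome_prob (minus_state u) y = (u y)\<^sup>2"
  by (simp add: outcome_prob_def minus_state_def tensor_vec_def ket_minus_def ket_def axis_def
      UNIV_bit norm_mult norm_divide power_mult_distrib power_divide)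

lemma hadamard_layer_initial:
  "hadamard_layer *v tensor_vec (tensor_power_vec (ket 0)) ket_minus =
    minus_state (\<lambda>x :: 'n::finite bits. 1 / sqrt 2 ^ CARD('n))"
proof -
  have "hadamard_transform (\<lambda>x :: 'n bits. of_bool (x = 0)) = (\<lambda>x. 1 / sqrt 2 ^ CARD('n))"
    by (simp add: hadamard_transform_def bit_dot_def fun_eq_iff)
  moreover have "tensor_vec (tensor_power_vec (ket 0)) ket_minus =
      minus_state (\<lambda>x :: 'n bits. of_bool (x = 0))"
    unfolding tensor_power_vec_ket_0
    by (simp add: minus_state_def ket_def axis_def of_bool_def
        if_distrib[of complex_of_real] cong: if_cong)
  ultimately show ?thesis by (simp add: hadamard_layer_minus_state)
qed

text \<open>One factor \<open>1 / sqrt 2 ^ n\<close> comes from the uniform superposition and one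
  from the transform; together they give \<open>1 / 2 ^ n\<close>.\<close>

lemma hadamard_transform_sign_function:
  "hadamard_transform (\<lambda>x. of_int (f x) * (1 / sqrt 2 ^ CARD('n))) w =
    of_int (walsh f w) / 2 ^ CARD('n)" for w :: "'n::finite bits"
proof -
  have "sqrt 2 ^ CARD('n) * sqrt 2 ^ CARD('n) = 2 ^ CARD('n)"
    by (simp flip: power_mult_distrib)
  then show ?thesis
    by (simp add: hadamard_transform_def walsh_def bit_sign_def mult.commute
        flip: sum_divide_distrib)
qed

theorem theorem4:
  fixes f g :: "bit ^ 'n \<Rightarrow> int"
    and S :: "(bit ^ 'n) set"
    and p :: real
  assumes "\<And>x. f x \<in> {1, -1}"
    and "\<And>x. g x = (if x \<in> S then -1 else 1)"
    and "p = 1 / 2 ^ (2 * CARD('n)) * (\<Sum>x\<in>S. (real_of_int (walsh f x))\<^sup>2)"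
  shows "algorithm33_prob f g f {y. \<exists>i. y $ i = 1} = 4 * p - 4 * p\<^sup>2"
proof -
  \<comment> \<open>The amplitudes after the first oracle (\<phi>) and after the second, third and
    fourth Hadamard layers (\<omega>, \<psi>, \<rho>).\<close>
  define \<phi> :: "'n bits \<Rightarrow> real" where "\<phi> = (\<lambda>x. of_int (f x) * (1 / sqrt 2 ^ CARD('n)))"
  define \<omega> where "\<omega> = hadamard_transform \<phi>"
  define \<psi> where "\<psi> = hadamard_transform (\<lambda>w. of_int (g w) * \<omega> w)"
  define \<rho> where "\<rho> = hadamard_transform (\<lambda>x. of_int (f x) * \<psi> x)"
  have g: "g x \<in> {1, -1}" for x
    by (simp add: assms(2))
  have f_sq: "(real_of_int (f x))\<^sup>2 = 1" and g_sq: "(real_of_int (g x))\<^sup>2 = 1" for x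
    using assms(1)[of x] g[of x] by auto
  have sqrt_sq: "(sqrt 2 ^ CARD('n))\<^sup>2 = (2 :: real) ^ CARD('n)"
    by (simp add: power2_eq_square flip: power_mult_distrib)
  have card: "real CARD('n bits) = 2 ^ CARD('n)"
    by (simp add: UNIV_bit)
  have norm_\<phi>: "(\<Sum>x\<in>UNIV. (\<phi> x)\<^sup>2) = 1"
    using card by (simp add: \<phi>_def power_mult_distrib power_divide f_sq sqrt_sq del: CARD_vec)
  have norm_\<omega>: "(\<Sum>w\<in>UNIV. (\<omega> w)\<^sup>2) = 1"
    by (simp add: \<omega>_def hadamard_transform_sum_squares norm_\<phi>)
  have norm_\<rho>: "(\<Sum>y\<in>UNIV. (\<rho> y)\<^sup>2) = 1"
    by (simp add: \<rho>_def \<psi>_def hadamard_transform_sum_squares power_mult_distrib f_sq g_sq norm_\<omega>)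
  have p: "p = (\<Sum>w\<in>S. (\<omega> w)\<^sup>2)"
  proof -
    have "\<omega> w = of_int (walsh f w) / 2 ^ CARD('n)" for w
      unfolding \<omega>_def \<phi>_def by (rule hadamard_transform_sign_function)
    then show ?thesis
      by (simp add: assms(3) power_divide sum_divide_distrib power_mult mult.commute[of 2])
  qed
  \<comment> \<open>At outcome \<open>0\<close> every character value is 1, so the last oracle's
    \<open>f\<close> and the scaling of the last layer recombine to \<phi>.\<close>
  have "\<rho> 0 = (\<Sum>x\<in>UNIV. \<phi> x * \<psi> x)"
    by (simp add: \<rho>_def hadamard_transform_def \<phi>_def bit_dot_def sum_divide_distrib)
  also have "\<dots> = (\<Sum>w\<in>UNIV. \<omega> w * (of_int (g w) * \<omega> w))"
    unfolding \<psi>_def \<omega>_def by (rule hadamard_transform_adjoint[symmetric])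
  \<comment> \<open>Here \<open>g\<close> is written as 1 minus twice the indicator of
    \<open>S\<close>.\<close>
  also have "\<dots> = (\<Sum>w\<in>UNIV. (\<omega> w)\<^sup>2 - 2 * (if w \<in> S then (\<omega> w)\<^sup>2 else 0))"
    by (intro sum.cong) (simp_all add: assms(2) power2_eq_square)
  also have "\<dots> = 1 - 2 * p"
    by (simp add: sum_subtractf norm_\<omega> p sum.If_cases flip: sum_distrib_left)
  finally have \<rho>_0: "\<rho> 0 = 1 - 2 * p" .
  \<comment> \<open>Removing \<open>insert_iff\<close> keeps the sign condition of
    \<open>U_gate_minus_state\<close> in the membership form in which \<open>assms(1)\<close> and
    \<open>g\<close> supply it.\<close>
  have state: "algorithm33_state f g f = minus_state \<rho>"
    by (simp add: algorithm33_state_def hadamard_layer_initial U_gate_minus_state assms(1) g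
        hadamard_layer_minus_state \<rho>_def \<psi>_def \<omega>_def \<phi>_def del: insert_iff)
  have "{y :: 'n bits. \<exists>i. y $ i = 1} = UNIV - {0}"
    by (auto simp: vec_eq_iff)
  then have "algorithm33_prob f g f {y. \<exists>i. y $ i = 1} = (\<Sum>y\<in>UNIV - {0}. (\<rho> y)\<^sup>2)"
    by (simp add: algorithm33_prob_def state outcome_prob_minus_state)
  also have "\<dots> = 1 - (1 - 2 * p)\<^sup>2"
    by (simp add: sum_diff1 norm_\<rho> \<rho>_0)
  also have "\<dots> = 4 * p - 4 * p\<^sup>2"
    by (simp add: power2_eq_square algebra_simps)
  finally show ?thesis .
qed

end
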